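(* Let $X$ be a finite non-empty set and let $\mathbf{SBA}_X$ be the free skew Boolean algebra on $X$. Then $X$ is a minimal generating set of $\mathbf{SBA}_X$. Conversely, $\mathbf{SBA}_X$ is free on each of its minimal generating sets. The left-handed and right-handed variants of both assertions (for the free left-handed, respectively right-handed, skew Boolean algebra on $X$, with freeness in the corresponding variety) also hold.
   Context: A skew lattice is an algebra $(S;\wedge,\vee)$ with associative binary operations satisfying $x\wedge(x\vee y)=x=(y\vee x)\wedge x$ and $x\vee(x\wedge y)=x=(y\wedge x)\vee x$. A skew Boolean algebra is an algebra $(S;\wedge,\vee,\setminus,0)$ such that $(S;\wedge,\vee)$ is a skew lattice satisfying $x\wedge(y\vee z)=(x\wedge y)\vee(x\wedge z)$ and $(x\vee y)\wedge z=(x\wedge z)\vee(y\wedge z)$, $0$ satisfies $0\wedge x=0=x\wedge 0$ and $0\vee x=x=x\vee 0$, and $(x\wedge y\wedge x)\vee(x\setminus y)=x$, $(x\wedge y\wedge x)\wedge(x\setminus y)=0=(x\setminus y)\wedge(x\wedge y\wedge x)$. It is left-handed if $x\wedge y\wedge x=x\wedge y$ and $x\vee y\vee x=y\vee x$ hold, right-handed if $x\wedge y\wedge x=y\wedge x$ and $x\vee y\vee x=x\vee y$ hold. Each of these classes is a variety, and free algebras are taken in the respective variety. A generating set of a finite skew Boolean algebra $\mathbf S$ is a minimal generating set if no other generating set of $\mathbf S$ has fewer members (minimal cardinality). *)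

theory Defs
  imports Main
begin

record 'a skew_algebra =
  carrier :: "'a set"
  meet :: "'a \<Rightarrow> 'a \<Rightarrow> 'a" (infixl "\<sqinter>\<index>" 70)
  join :: "'a \<Rightarrow> 'a \<Rightarrow> 'a" (infixl "\<squnion>\<index>" 65)
  diff :: "'a \<Rightarrow> 'a \<Rightarrow> 'a" (infixl "\<setminus>\<index>" 70)
  zero :: 'a ("\<zero>\<index>")

locale skew_lattice =
  fixes S (structure)
  assumes meet_closed: "\<lbrakk>x \<in> carrier S; y \<in> carrier S\<rbrakk> \<Longrightarrow> x \<sqinter> y \<in> carrier S"
    and join_closed: "\<lbrakk>x \<in> carrier S; y \<in> carrier S\<rbrakk> \<Longrightarrow> x \<squnion> y \<in> carrier S"
    and meet_assoc: "\<lbrakk>x \<in> carrier S; y \<in> carrier S; z \<in> carrier S\<rbrakk> \<Longrightarrow>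
      (x \<sqinter> y) \<sqinter> z = x \<sqinter> (y \<sqinter> z)"
    and join_assoc: "\<lbrakk>x \<in> carrier S; y \<in> carrier S; z \<in> carrier S\<rbrakk> \<Longrightarrow>
      (x \<squnion> y) \<squnion> z = x \<squnion> (y \<squnion> z)"
    and meet_absorb_left: "\<lbrakk>x \<in> carrier S; y \<in> carrier S\<rbrakk> \<Longrightarrow> x \<sqinter> (x \<squnion> y) = x"
    and meet_absorb_right: "\<lbrakk>x \<in> carrier S; y \<in> carrier S\<rbrakk> \<Longrightarrow> (y \<squnion> x) \<sqinter> x = x"
    and join_absorb_left: "\<lbrakk>x \<in> carrier S; y \<in> carrier S\<rbrakk> \<Longrightarrow> x \<squnion> (x \<sqinter> y) = x"
    and join_absorb_right: "\<lbrakk>x \<in> carrier S; y \<in> carrier S\<rbrakk> \<Longrightarrow> (y \<sqinter> x) \<squnion> x = x"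

locale skew_boolean_algebra = skew_lattice S for S (structure) +
  assumes diff_closed: "\<lbrakk>x \<in> carrier S; y \<in> carrier S\<rbrakk> \<Longrightarrow> x \<setminus> y \<in> carrier S"
    and zero_closed: "\<zero> \<in> carrier S"
    and meet_join_distrib: "\<lbrakk>x \<in> carrier S; y \<in> carrier S; z \<in> carrier S\<rbrakk> \<Longrightarrow>
      x \<sqinter> (y \<squnion> z) = (x \<sqinter> y) \<squnion> (x \<sqinter> z)"
    and join_meet_distrib: "\<lbrakk>x \<in> carrier S; y \<in> carrier S; z \<in> carrier S\<rbrakk> \<Longrightarrow>
      (x \<squnion> y) \<sqinter> z = (x \<sqinter> z) \<squnion> (y \<sqinter> z)"
    and zero_meet: "x \<in> carrier S \<Longrightarrow> \<zero> \<sqinter> x = \<zero>"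
    and meet_zero: "x \<in> carrier S \<Longrightarrow> x \<sqinter> \<zero> = \<zero>"
    and zero_join: "x \<in> carrier S \<Longrightarrow> \<zero> \<squnion> x = x"
    and join_zero: "x \<in> carrier S \<Longrightarrow> x \<squnion> \<zero> = x"
    and diff_join: "\<lbrakk>x \<in> carrier S; y \<in> carrier S\<rbrakk> \<Longrightarrow> (x \<sqinter> y \<sqinter> x) \<squnion> (x \<setminus> y) = x"
    and meet_diff: "\<lbrakk>x \<in> carrier S; y \<in> carrier S\<rbrakk> \<Longrightarrow> (x \<sqinter> y \<sqinter> x) \<sqinter> (x \<setminus> y) = \<zero>"
    and diff_meet: "\<lbrakk>x \<in> carrier S; y \<in> carrier S\<rbrakk> \<Longrightarrow> (x \<setminus> y) \<sqinter> (x \<sqinter> y \<sqinter> x) = \<zero>"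

locale left_handed_skew_boolean_algebra = skew_boolean_algebra S for S (structure) +
  assumes left_meet: "\<lbrakk>x \<in> carrier S; y \<in> carrier S\<rbrakk> \<Longrightarrow> x \<sqinter> y \<sqinter> x = x \<sqinter> y"
    and left_join: "\<lbrakk>x \<in> carrier S; y \<in> carrier S\<rbrakk> \<Longrightarrow> x \<squnion> y \<squnion> x = y \<squnion> x"

locale right_handed_skew_boolean_algebra = skew_boolean_algebra S for S (structure) +
  assumes right_meet: "\<lbrakk>x \<in> carrier S; y \<in> carrier S\<rbrakk> \<Longrightarrow> x \<sqinter> y \<sqinter> x = y \<sqinter> x"
    and right_join: "\<lbrakk>x \<in> carrier S; y \<in> carrier S\<rbrakk> \<Longrightarrow> x \<squnion> y \<squnion> x = x \<squnion> y"

datatype sba_variety = SBA | Left_Handed_SBA | Right_Handed_SBA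

fun in_variety :: "sba_variety \<Rightarrow> 'a skew_algebra \<Rightarrow> bool" where
  "in_variety SBA S = skew_boolean_algebra S"
| "in_variety Left_Handed_SBA S = left_handed_skew_boolean_algebra S"
| "in_variety Right_Handed_SBA S = right_handed_skew_boolean_algebra S"

definition skew_hom :: "'a skew_algebra \<Rightarrow> 'b skew_algebra \<Rightarrow> ('a \<Rightarrow> 'b) set" where
  "skew_hom S T = {h. h ` carrier S \<subseteq> carrier T \<and> h \<zero>\<^bsub>S\<^esub> = \<zero>\<^bsub>T\<^esub> \<and>
     (\<forall>x\<in>carrier S. \<forall>y\<in>carrier S.
        h (x \<sqinter>\<^bsub>S\<^esub> y) = h x \<sqinter>\<^bsub>T\<^esub> h y \<and>
        h (x \<squnion>\<^bsub>S\<^esub> y) = h x \<squnion>\<^bsub>T\<^esub> h y \<and>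
        h (x \<setminus>\<^bsub>S\<^esub> y) = h x \<setminus>\<^bsub>T\<^esub> h y)}"

inductive_set generated :: "'a skew_algebra \<Rightarrow> 'a set \<Rightarrow> 'a set"
  for S :: "'a skew_algebra" and Y :: "'a set" where
  gen_incl: "y \<in> Y \<Longrightarrow> y \<in> generated S Y"
| gen_zero: "\<zero>\<^bsub>S\<^esub> \<in> generated S Y"
| gen_meet: "\<lbrakk>x \<in> generated S Y; y \<in> generated S Y\<rbrakk> \<Longrightarrow> x \<sqinter>\<^bsub>S\<^esub> y \<in> generated S Y"
| gen_join: "\<lbrakk>x \<in> generated S Y; y \<in> generated S Y\<rbrakk> \<Longrightarrow> x \<squnion>\<^bsub>S\<^esub> y \<in> generated S Y"
| gen_diff: "\<lbrakk>x \<in> generated S Y; y \<in> generated S Y\<rbrakk> \<Longrightarrow> x \<setminus>\<^bsub>S\<^esub> y \<in> generated S Y"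

definition generating_set :: "'a skew_algebra \<Rightarrow> 'a set \<Rightarrow> bool" where
  "generating_set S Y \<longleftrightarrow> Y \<subseteq> carrier S \<and> generated S Y = carrier S"

text \<open>Minimal means of minimal cardinality, not minimal under inclusion. The notion is for finite
  algebras only, so all the cardinalities compared are those of finite sets.\<close>

definition minimal_generating_set :: "'a skew_algebra \<Rightarrow> 'a set \<Rightarrow> bool" where
  "minimal_generating_set S Y \<longleftrightarrow> finite (carrier S) \<and> generating_set S Y \<and>
     (\<forall>Z. generating_set S Z \<longrightarrow> card Y \<le> card Z)"

datatype 'x skew_term =
    Var 'x
  | Zero
  | Meet "'x skew_term" "'x skew_term"
  | Join "'x skew_term" "'x skew_term"
  | Diff "'x skew_term" "'x skew_term"

text \<open>\<open>S\<close> is free on \<open>X\<close> in a variety if \<open>S\<close> is in the variety, \<open>X\<close> generates \<open>S\<close>, and every map from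
  \<open>X\<close> to an algebra \<open>T\<close> of the variety extends to a homomorphism. A definition cannot quantify over
  the type of the elements of \<open>T\<close>; it is taken to be the type of terms over the type of \<open>S\<close>. This is
  no restriction, because only the subalgebra of \<open>T\<close> generated by the image of \<open>X\<close> matters and its
  elements are values of terms: the universal property for \<open>T\<close> over an arbitrary type is
  \<open>free_on_universal\<close> below, and free algebras exist by \<open>free_on_exists\<close>.\<close>

definition free_on :: "sba_variety \<Rightarrow> 'a skew_algebra \<Rightarrow> 'a set \<Rightarrow> bool" where
  "free_on V S X \<longleftrightarrow> in_variety V S \<and> generating_set S X \<and>
     (\<forall>(T :: 'a skew_term skew_algebra) f. in_variety V T \<and> f ` X \<subseteq> carrier T \<longrightarrow>
        (\<exists>h \<in> skew_hom S T. \<forall>x\<in>X. h x = f x))"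

lemma in_variety_sba: "in_variety V S \<Longrightarrow> skew_boolean_algebra S"
  by (cases V)
    (auto simp: left_handed_skew_boolean_algebra_def right_handed_skew_boolean_algebra_def)

lemma sba_closed:
  assumes "in_variety V S"
  shows "\<zero>\<^bsub>S\<^esub> \<in> carrier S"
    and "\<lbrakk>x \<in> carrier S; y \<in> carrier S\<rbrakk> \<Longrightarrow> x \<sqinter>\<^bsub>S\<^esub> y \<in> carrier S"
    and "\<lbrakk>x \<in> carrier S; y \<in> carrier S\<rbrakk> \<Longrightarrow> x \<squnion>\<^bsub>S\<^esub> y \<in> carrier S"
    and "\<lbrakk>x \<in> carrier S; y \<in> carrier S\<rbrakk> \<Longrightarrow> x \<setminus>\<^bsub>S\<^esub> y \<in> carrier S"
proof -
  interpret skew_boolean_algebra S using in_variety_sba[OF assms] .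
  show "\<zero>\<^bsub>S\<^esub> \<in> carrier S"
    and "\<lbrakk>x \<in> carrier S; y \<in> carrier S\<rbrakk> \<Longrightarrow> x \<sqinter>\<^bsub>S\<^esub> y \<in> carrier S"
    and "\<lbrakk>x \<in> carrier S; y \<in> carrier S\<rbrakk> \<Longrightarrow> x \<squnion>\<^bsub>S\<^esub> y \<in> carrier S"
    and "\<lbrakk>x \<in> carrier S; y \<in> carrier S\<rbrakk> \<Longrightarrow> x \<setminus>\<^bsub>S\<^esub> y \<in> carrier S"
    by (auto intro: zero_closed meet_closed join_closed diff_closed)
qed

text \<open>An algebra whose points are separated by homomorphisms to members of a variety is in the
  variety.\<close>

lemma in_variety_separating:
  fixes S :: "'a skew_algebra" and T :: "'i \<Rightarrow> 'b skew_algebra"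
  assumes T: "\<And>i. i \<in> I \<Longrightarrow> in_variety V (T i)"
    and h: "\<And>i. i \<in> I \<Longrightarrow> h i \<in> skew_hom S (T i)"
    and sep: "\<And>x y. \<lbrakk>x \<in> carrier S; y \<in> carrier S; \<And>i. i \<in> I \<Longrightarrow> h i x = h i y\<rbrakk> \<Longrightarrow> x = y"
    and cl: "\<zero>\<^bsub>S\<^esub> \<in> carrier S"
      "\<And>x y. \<lbrakk>x \<in> carrier S; y \<in> carrier S\<rbrakk> \<Longrightarrow> x \<sqinter>\<^bsub>S\<^esub> y \<in> carrier S"
      "\<And>x y. \<lbrakk>x \<in> carrier S; y \<in> carrier S\<rbrakk> \<Longrightarrow> x \<squnion>\<^bsub>S\<^esub> y \<in> carrier S"
      "\<And>x y. \<lbrakk>x \<in> carrier S; y \<in> carrier S\<rbrakk> \<Longrightarrow> x \<setminus>\<^bsub>S\<^esub> y \<in> carrier S"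
  shows "in_variety V S"
proof -
  have hs: "h i x \<in> carrier (T i)" "h i \<zero>\<^bsub>S\<^esub> = \<zero>\<^bsub>T i\<^esub>"
    "h i (x \<sqinter>\<^bsub>S\<^esub> y) = h i x \<sqinter>\<^bsub>T i\<^esub> h i y"
    "h i (x \<squnion>\<^bsub>S\<^esub> y) = h i x \<squnion>\<^bsub>T i\<^esub> h i y"
    "h i (x \<setminus>\<^bsub>S\<^esub> y) = h i x \<setminus>\<^bsub>T i\<^esub> h i y"
    if "i \<in> I" "x \<in> carrier S" "y \<in> carrier S" for i x y
    using h[OF that(1)] that by (auto simp: skew_hom_def)
  have h0: "h i \<zero>\<^bsub>S\<^esub> = \<zero>\<^bsub>T i\<^esub>" if "i \<in> I" for i
    using h[OF that] by (auto simp: skew_hom_def)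
  have B: "skew_boolean_algebra (T i)" if "i \<in> I" for i
    using in_variety_sba[OF T[OF that]] .
  note L = B[unfolded skew_boolean_algebra_def, THEN conjunct1]
  have sba: "skew_boolean_algebra S"
    by unfold_locales (auto intro!: cl sep skew_lattice.meet_assoc[OF L]
      skew_lattice.join_assoc[OF L] simp: hs h0 cl
      skew_lattice.meet_absorb_left[OF L] skew_lattice.meet_absorb_right[OF L]
      skew_lattice.join_absorb_left[OF L] skew_lattice.join_absorb_right[OF L]
      skew_boolean_algebra.meet_join_distrib[OF B] skew_boolean_algebra.join_meet_distrib[OF B]
      skew_boolean_algebra.zero_meet[OF B] skew_boolean_algebra.meet_zero[OF B]
      skew_boolean_algebra.zero_join[OF B] skew_boolean_algebra.join_zero[OF B]
      skew_boolean_algebra.diff_join[OF B] skew_boolean_algebra.meet_diff[OF B]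
      skew_boolean_algebra.diff_meet[OF B])
  show ?thesis
  proof (cases V)
    case SBA
    then show ?thesis using sba by simp
  next
    case Left_Handed_SBA
    then have "left_handed_skew_boolean_algebra (T i)" if "i \<in> I" for i using T[OF that] by simp
    note H = this
    have "left_handed_skew_boolean_algebra S"
      unfolding left_handed_skew_boolean_algebra_def left_handed_skew_boolean_algebra_axioms_def
      by (auto intro!: sba cl sep simp: hs cl left_handed_skew_boolean_algebra.left_meet[OF H]
          left_handed_skew_boolean_algebra.left_join[OF H])
    then show ?thesis using Left_Handed_SBA by simp
  next
    case Right_Handed_SBA
    then have "right_handed_skew_boolean_algebra (T i)" if "i \<in> I" for i using T[OF that] by simp
    note H = this
    have "right_handed_skew_boolean_algebra S"
      unfolding right_handed_skew_boolean_algebra_def right_handed_skew_boolean_algebra_axioms_def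
      by (auto intro!: sba cl sep simp: hs cl right_handed_skew_boolean_algebra.right_meet[OF H]
          right_handed_skew_boolean_algebra.right_join[OF H])
    then show ?thesis using Right_Handed_SBA by simp
  qed
qed

primrec term_value :: "'a skew_algebra \<Rightarrow> ('x \<Rightarrow> 'a) \<Rightarrow> 'x skew_term \<Rightarrow> 'a" where
  "term_value S f (Var x) = f x"
| "term_value S f Zero = \<zero>\<^bsub>S\<^esub>"
| "term_value S f (Meet s t) = term_value S f s \<sqinter>\<^bsub>S\<^esub> term_value S f t"
| "term_value S f (Join s t) = term_value S f s \<squnion>\<^bsub>S\<^esub> term_value S f t"
| "term_value S f (Diff s t) = term_value S f s \<setminus>\<^bsub>S\<^esub> term_value S f t"

lemma term_value_closed:
  assumes "in_variety V S" "f ` X \<subseteq> carrier S" "set_skew_term t \<subseteq> X"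
  shows "term_value S f t \<in> carrier S"
  using assms(3) by (induction t) (use assms in \<open>auto intro!: sba_closed[OF assms(1)]\<close>)

lemma generated_eq_term_values:
  "generated S (f ` X) = term_value S f ` {t. set_skew_term t \<subseteq> X}"
proof
  show "generated S (f ` X) \<subseteq> term_value S f ` {t. set_skew_term t \<subseteq> X}"
  proof
    fix y assume "y \<in> generated S (f ` X)"
    then have "\<exists>t. set_skew_term t \<subseteq> X \<and> y = term_value S f t"
    proof induction
      case (gen_incl y)
      then obtain x where "x \<in> X" "y = f x" by auto
      then show ?case by (intro exI[of _ "Var x"]) auto
    next
      case gen_zero
      show ?case by (intro exI[of _ Zero]) auto
    next
      case (gen_meet x y)
      then obtain s t where "set_skew_term s \<subseteq> X" "x = term_value S f s"
        "set_skew_term t \<subseteq> X" "y = term_value S f t" by blast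
      then show ?case by (intro exI[of _ "Meet s t"]) auto
    next
      case (gen_join x y)
      then obtain s t where "set_skew_term s \<subseteq> X" "x = term_value S f s"
        "set_skew_term t \<subseteq> X" "y = term_value S f t" by blast
      then show ?case by (intro exI[of _ "Join s t"]) auto
    next
      case (gen_diff x y)
      then obtain s t where "set_skew_term s \<subseteq> X" "x = term_value S f s"
        "set_skew_term t \<subseteq> X" "y = term_value S f t" by blast
      then show ?case by (intro exI[of _ "Diff s t"]) auto
    qed
    then show "y \<in> term_value S f ` {t. set_skew_term t \<subseteq> X}" by auto
  qed
  have "term_value S f t \<in> generated S (f ` X)" if "set_skew_term t \<subseteq> X" for t
    using that by (induction t) (auto intro: generated.intros)
  then show "term_value S f ` {t. set_skew_term t \<subseteq> X} \<subseteq> generated S (f ` X)" by auto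
qed

lemma skew_hom_term_value:
  assumes "in_variety V S" "h \<in> skew_hom S T" "f ` X \<subseteq> carrier S" "set_skew_term t \<subseteq> X"
  shows "h (term_value S f t) = term_value T (h \<circ> f) t"
  using assms(4)
proof (induction t)
qed (use assms(2) in \<open>auto simp: skew_hom_def term_value_closed[OF assms(1,3)]\<close>)

lemma skew_hom_comp:
  "\<lbrakk>h \<in> skew_hom S T; k \<in> skew_hom T U\<rbrakk> \<Longrightarrow> k \<circ> h \<in> skew_hom S U"
  unfolding skew_hom_def by auto (simp_all add: image_subset_iff)

text \<open>A map from \<open>X\<close> to an algebra of the variety factors through one on the type of terms.\<close>

lemma factor_through_terms:
  fixes T :: "'b skew_algebra" and f :: "'x \<Rightarrow> 'b"
  assumes T: "in_variety V T" and f: "f ` X \<subseteq> carrier T"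
  obtains U :: "'x skew_term skew_algebra" and g k
  where "in_variety V U" "g ` X \<subseteq> carrier U" "k \<in> skew_hom U T" "\<And>x. x \<in> X \<Longrightarrow> k (g x) = f x"
proof -
  define G where "G = generated T (f ` X)"
  define c where "c b = (SOME t. set_skew_term t \<subseteq> X \<and> term_value T f t = b)" for b
  let ?k = "term_value T f"
  have c: "set_skew_term (c b) \<subseteq> X \<and> ?k (c b) = b" if "b \<in> G" for b
    using that unfolding c_def G_def generated_eq_term_values
    by (intro someI_ex[of "\<lambda>t. set_skew_term t \<subseteq> X \<and> ?k t = b"]) auto
  have GT: "G \<subseteq> carrier T"
    unfolding G_def generated_eq_term_values using term_value_closed[OF T f] by auto
  define U where "U = \<lparr>carrier = c ` G, meet = \<lambda>s t. c (?k s \<sqinter>\<^bsub>T\<^esub> ?k t),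
    join = \<lambda>s t. c (?k s \<squnion>\<^bsub>T\<^esub> ?k t), diff = \<lambda>s t. c (?k s \<setminus>\<^bsub>T\<^esub> ?k t), zero = c \<zero>\<^bsub>T\<^esub>\<rparr>"
  have G: "\<zero>\<^bsub>T\<^esub> \<in> G" "f x \<in> G" if "x \<in> X" for x
    using that by (auto simp: G_def intro: generated.intros)
  have G0: "\<zero>\<^bsub>T\<^esub> \<in> G" by (auto simp: G_def intro: generated.intros)
  have G2: "a \<sqinter>\<^bsub>T\<^esub> b \<in> G" "a \<squnion>\<^bsub>T\<^esub> b \<in> G" "a \<setminus>\<^bsub>T\<^esub> b \<in> G" if "a \<in> G" "b \<in> G" for a b
    using that by (auto simp: G_def intro: generated.intros)
  have k: "?k \<in> skew_hom U T"
    using GT by (auto simp: skew_hom_def U_def c G0 G2)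
  have "in_variety V U"
    by (rule in_variety_separating[of "{()}" V "\<lambda>_. T" "\<lambda>_. ?k"])
      (use T k in \<open>auto simp: U_def c G0 G2\<close>)
  moreover have "(c \<circ> f) ` X \<subseteq> carrier U" using G by (auto simp: U_def)
  moreover have "?k ((c \<circ> f) x) = f x" if "x \<in> X" for x using c G that by simp
  ultimately show thesis using that k by blast
qed

theorem free_on_universal:
  fixes S :: "'a skew_algebra" and T :: "'b skew_algebra"
  assumes S: "free_on V S X" and T: "in_variety V T" "f ` X \<subseteq> carrier T"
  shows "\<exists>h \<in> skew_hom S T. (\<forall>x\<in>X. h x = f x) \<and>
    (\<forall>h' \<in> skew_hom S T. (\<forall>x\<in>X. h' x = f x) \<longrightarrow> (\<forall>y\<in>carrier S. h' y = h y))"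
proof -
  obtain U :: "'a skew_term skew_algebra" and g k
    where U: "in_variety V U" "g ` X \<subseteq> carrier U" "k \<in> skew_hom U T"
      "\<And>x. x \<in> X \<Longrightarrow> k (g x) = f x"
    using factor_through_terms[OF T] by blast
  obtain h where h: "h \<in> skew_hom S U" "\<forall>x\<in>X. h x = g x"
    using S U(1,2) unfolding free_on_def by blast
  have V: "in_variety V S" and gen: "generated S (id ` X) = carrier S" "id ` X \<subseteq> carrier S"
    using S by (auto simp: free_on_def generating_set_def)
  have uniq: "h1 y = h2 y"
    if h12: "h1 \<in> skew_hom S T" "h2 \<in> skew_hom S T" "\<forall>x\<in>X. h1 x = h2 x"
      and y: "y \<in> carrier S" for h1 h2 y
  proof -
    obtain t where t: "set_skew_term t \<subseteq> X" "y = term_value S id t"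
      using y unfolding gen(1)[symmetric] generated_eq_term_values by auto
    have "term_value T (h1 \<circ> id) t = term_value T (h2 \<circ> id) t"
      using t(1) by (induction t) (use h12(3) in auto)
    then show ?thesis
      using t(2) skew_hom_term_value[OF V h12(1) gen(2) t(1)]
        skew_hom_term_value[OF V h12(2) gen(2) t(1)] by simp
  qed
  show ?thesis
  proof (intro bexI[of _ "k \<circ> h"] conjI ballI impI)
    show kh: "k \<circ> h \<in> skew_hom S T" by (rule skew_hom_comp[OF h(1) U(3)])
    show kh_X: "(k \<circ> h) x = f x" if "x \<in> X" for x using that h(2) U(4) by simp
    show "h' y = (k \<circ> h) y"
      if "h' \<in> skew_hom S T" "\<forall>x\<in>X. h' x = f x" "y \<in> carrier S" for h' y
      by (rule uniq[OF that(1) kh _ that(3)]) (use that(2) kh_X in simp)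
  qed
qed

lemma two_element_algebra:
  assumes "a \<noteq> z"
  shows "in_variety V \<lparr>carrier = {z, a}, meet = \<lambda>x y. if x = z then z else y,
    join = \<lambda>x y. if x = z then y else x, diff = \<lambda>x y. if y = z then x else z, zero = z\<rparr>"
  using assms by (cases V) (simp_all, (unfold_locales, auto)+)

theorem free_on_exists:
  fixes X :: "'x set"
  obtains S :: "('x skew_term skew_algebra \<times> ('x \<Rightarrow> 'x skew_term) \<Rightarrow> 'x skew_term) skew_algebra"
    and e where "inj_on e X" "free_on V S (e ` X)"
proof -
  define I :: "('x skew_term skew_algebra \<times> ('x \<Rightarrow> 'x skew_term)) set"
    where "I = {(T, f). in_variety V T \<and> f ` X \<subseteq> carrier T}"
  define e :: "'x \<Rightarrow> 'x skew_term skew_algebra \<times> ('x \<Rightarrow> 'x skew_term) \<Rightarrow> 'x skew_term"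
    where "e x i = (if i \<in> I then snd i x else Zero)" for x i
  define P :: "('x skew_term skew_algebra \<times> ('x \<Rightarrow> 'x skew_term) \<Rightarrow> 'x skew_term) skew_algebra"
    where "P = \<lparr>carrier = UNIV,
      meet = \<lambda>p q i. if i \<in> I then p i \<sqinter>\<^bsub>fst i\<^esub> q i else Zero,
      join = \<lambda>p q i. if i \<in> I then p i \<squnion>\<^bsub>fst i\<^esub> q i else Zero,
      diff = \<lambda>p q i. if i \<in> I then p i \<setminus>\<^bsub>fst i\<^esub> q i else Zero,
      zero = \<lambda>i. if i \<in> I then \<zero>\<^bsub>fst i\<^esub> else Zero\<rparr>"
  define S where "S = P\<lparr>carrier := generated P (e ` X)\<rparr>"
  have ops: "meet S = meet P" "join S = join P" "diff S = diff P" "zero S = zero P"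
    "carrier S = generated P (e ` X)" by (auto simp: S_def)
  have S_out: "p i = Zero" if "p \<in> carrier S" "i \<notin> I" for p i
    using that unfolding ops(5) by (induction) (auto simp: e_def P_def)
  have S_in: "p i \<in> carrier (fst i)" if "p \<in> carrier S" "i \<in> I" for p i
  proof -
    have "in_variety V (fst i)" "snd i ` X \<subseteq> carrier (fst i)" using that(2) by (auto simp: I_def)
    note sub = this(2) and cl = sba_closed[OF this(1)]
    show ?thesis using that(1) unfolding ops(5)
      by (induction rule: generated.induct)
        (use that(2) sub in \<open>auto simp: e_def P_def intro!: cl\<close>)
  qed
  have hom: "(\<lambda>p. p i) \<in> skew_hom S (fst i)" if "i \<in> I" for i
    using that S_in[OF _ that] by (auto simp: skew_hom_def ops(1-4) P_def)
  have V: "in_variety V S"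
  proof (rule in_variety_separating[of I V fst "\<lambda>i p. p i"])
    show "in_variety V (fst i)" if "i \<in> I" for i using that by (auto simp: I_def)
    show "x = y" if "x \<in> carrier S" "y \<in> carrier S" "\<And>i. i \<in> I \<Longrightarrow> x i = y i" for x y
      using S_out that by (metis ext)
  qed (auto simp: hom ops intro: generated.intros)
  have "generated S (e ` X) = generated P (e ` X)"
  proof -
    have "term_value S e t = term_value P e t" for t by (induction t) (auto simp: ops)
    then show ?thesis unfolding generated_eq_term_values by simp
  qed
  then have gen: "generating_set S (e ` X)"
    by (auto simp: generating_set_def ops intro: generated.intros)
  have inj: "inj_on e X"
  proof (rule inj_onI)
    fix x y assume xy: "x \<in> X" "y \<in> X" "e x = e y"
    define T :: "'x skew_term skew_algebra" where "T = \<lparr>carrier = {Zero, Var x},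
      meet = \<lambda>a b. if a = Zero then Zero else b, join = \<lambda>a b. if a = Zero then b else a,
      diff = \<lambda>a b. if b = Zero then a else Zero, zero = Zero\<rparr>"
    have "in_variety V T" unfolding T_def by (rule two_element_algebra) simp
    then have "(T, \<lambda>z. if z = x then Var x else Zero) \<in> I" by (auto simp: I_def T_def)
    with fun_cong[OF xy(3), of "(T, \<lambda>z. if z = x then Var x else Zero)"] show "x = y"
      by (auto simp: e_def split: if_splits)
  qed
  have "\<exists>h \<in> skew_hom S T. \<forall>x\<in>e ` X. h x = f x"
    if T: "in_variety V T" "f ` e ` X \<subseteq> carrier T"
    for T :: "('x skew_term skew_algebra \<times> ('x \<Rightarrow> 'x skew_term) \<Rightarrow> 'x skew_term) skew_term
      skew_algebra" and f
  proof -
    have "(f \<circ> e) ` X \<subseteq> carrier T" using T(2) by auto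
    then obtain U :: "'x skew_term skew_algebra" and g k where U: "in_variety V U"
      "g ` X \<subseteq> carrier U" "k \<in> skew_hom U T" "\<And>x. x \<in> X \<Longrightarrow> k (g x) = (f \<circ> e) x"
      using factor_through_terms[OF T(1)] by blast
    have i: "(U, g) \<in> I" using U by (auto simp: I_def)
    show ?thesis
      using skew_hom_comp[OF hom[OF i, simplified] U(3)] U(4) i
      by (intro bexI[of _ "k \<circ> (\<lambda>p. p (U, g))"]) (auto simp: e_def)
  qed
  then have "free_on V S (e ` X)" using V gen by (auto simp: free_on_def)
  with inj show thesis by (rule that)
qed

end

theory Submission
  imports Defs
begin

text \<open>Why the theorem is true. Every variety in question contains a two-element algebra. If \<open>S\<close> is
  free on \<open>X\<close>, its homomorphisms to that algebra correspond to the subsets of \<open>X\<close>, because their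
  values on \<open>X\<close> can be prescribed. They are also determined by their values on any generating
  set \<open>Z\<close>, so \<open>2 ^ card X \<le> 2 ^ card Z\<close> (\<open>free_generators_le_generating_set\<close>).

  Conversely, let \<open>Y\<close> generate \<open>S\<close> and have as many elements as \<open>X\<close>. A bijection from \<open>X\<close> to \<open>Y\<close>
  extends to an endomorphism of \<open>S\<close>. It is onto because \<open>Y\<close> generates, hence bijective if \<open>S\<close> is
  finite, and this automorphism carries freeness from \<open>X\<close> to \<open>Y\<close>.

  The substance is therefore that a finitely generated skew Boolean algebra is finite
  (\<open>finitely_generated_finite\<close>). Each element \<open>e\<close> splits \<open>S\<close> as a direct product of the ideal of
  the elements lying below \<open>e\<close> up to equivalence and the annihilator of \<open>e\<close>, where \<open>a\<close> and
  \<open>b\<close> are equivalent if \<open>a \<sqinter> b \<sqinter> a = a\<close> and \<open>b \<sqinter> a \<sqinter> b = b\<close>. The two projections are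
  \<open>z \<sqinter> e \<sqinter> z\<close> and \<open>z \<setminus> e\<close>; as endomorphisms of \<open>S\<close> they jointly separate points
  (\<open>component_homs\<close>). The first makes \<open>e\<close> maximal in its image, the second sends \<open>e\<close> to zero.
  Splitting along one generator after another embeds \<open>S\<close> into a finite product of algebras in
  which every generator is zero or maximal. The maximal generators are then pairwise equivalent,
  and such generators produce no more than zero and the meets of two of them
  (\<open>finite_generated_by_class\<close>).

  That the projections are homomorphisms rests on normality of the meet,
  \<open>x \<sqinter> y \<sqinter> z \<sqinter> w = x \<sqinter> z \<sqinter> y \<sqinter> w\<close>, which is extracted from the two distributive laws
  (\<open>meet_commute_below\<close>, \<open>meet_normal\<close>).\<close>

section \<open>Normality of the meet\<close>

context skew_boolean_algebra
begin

lemmas closed [simp] = meet_closed join_closed diff_closed zero_closed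

lemma meet_idem [simp]: "x \<in> carrier S \<Longrightarrow> x \<sqinter> x = x"
  by (metis join_zero meet_absorb_left zero_closed)

lemma meet_idem_left [simp]: "\<lbrakk>x \<in> carrier S; y \<in> carrier S\<rbrakk> \<Longrightarrow> x \<sqinter> (x \<sqinter> y) = x \<sqinter> y"
  by (metis meet_assoc meet_idem)

lemma meet_idem_pair [simp]:
  "\<lbrakk>x \<in> carrier S; y \<in> carrier S\<rbrakk> \<Longrightarrow> x \<sqinter> (y \<sqinter> (x \<sqinter> y)) = x \<sqinter> y"
  using meet_idem[of "x \<sqinter> y"] by (simp only: meet_assoc closed)

lemma meet_idem_pair_left [simp]:
  "\<lbrakk>x \<in> carrier S; y \<in> carrier S; z \<in> carrier S\<rbrakk> \<Longrightarrow>
    x \<sqinter> (y \<sqinter> (x \<sqinter> (y \<sqinter> z))) = x \<sqinter> (y \<sqinter> z)"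
  using meet_idem_left[of "x \<sqinter> y" z] by (simp only: meet_assoc closed)

text \<open>Joining \<open>a\<close> to \<open>x\<close> on either side gives \<open>x\<close> back. Hence each distributive law, applied to \<open>b\<close>
  below that join, absorbs one of the products \<open>a \<sqinter> b\<close>, \<open>b \<sqinter> a\<close> into \<open>b\<close>, and both products come
  out equal to \<open>b \<sqinter> a \<sqinter> b\<close>.\<close>

lemma meet_commute_below:
  assumes c: "x \<in> carrier S" "a \<in> carrier S" "b \<in> carrier S"
    and a: "x \<sqinter> a = a" "a \<sqinter> x = a" and b: "x \<sqinter> b = b" "b \<sqinter> x = b"
  shows "a \<sqinter> b = b \<sqinter> a"
proof -
  have ax: "x \<squnion> a = x" "a \<squnion> x = x"
    using join_absorb_left[of x a] join_absorb_right[of x a] c a by auto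
  have "b \<squnion> (a \<sqinter> b) = b"
    using join_meet_distrib[of x a b] c ax b by simp
  then have 1: "b \<sqinter> (a \<sqinter> b) = a \<sqinter> b"
    using meet_absorb_right[of "a \<sqinter> b" b] c by simp
  have "(b \<sqinter> a) \<squnion> b = b"
    using meet_join_distrib[of b a x] c ax b by simp
  then have "(b \<sqinter> a) \<sqinter> b = b \<sqinter> a"
    using meet_absorb_left[of "b \<sqinter> a" b] c by simp
  then show ?thesis using 1 c by (simp add: meet_assoc)
qed

text \<open>Both sides lie below \<open>x\<close>, so they commute; they are also equivalent in the band of meets, and
  commuting equivalent idempotents are equal.\<close>

lemma meet_insert_middle:
  assumes c: "x \<in> carrier S" "p \<in> carrier S" "q \<in> carrier S"
  shows "x \<sqinter> (p \<sqinter> (x \<sqinter> (q \<sqinter> x))) = x \<sqinter> (p \<sqinter> (q \<sqinter> x))"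
proof -
  define v where "v = x \<sqinter> (p \<sqinter> (x \<sqinter> (q \<sqinter> x)))"
  define w where "w = x \<sqinter> (p \<sqinter> (q \<sqinter> x))"
  note d = v_def w_def meet_assoc c
  have vw: "v \<sqinter> w = w \<sqinter> v" by (rule meet_commute_below[of x]) (simp_all add: d)
  have p: "(x \<sqinter> p \<sqinter> x) \<sqinter> w = w" by (simp add: d)
  have "(x \<sqinter> q \<sqinter> x) \<sqinter> w = w \<sqinter> (x \<sqinter> q \<sqinter> x)"
    by (rule meet_commute_below[of x]) (simp_all add: d)
  also have "\<dots> = w" by (simp add: d)
  finally have q: "(x \<sqinter> q \<sqinter> x) \<sqinter> w = w" .
  have "v \<sqinter> w = (x \<sqinter> p \<sqinter> x) \<sqinter> ((x \<sqinter> q \<sqinter> x) \<sqinter> w)" by (simp add: d)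
  then have w: "v \<sqinter> w = w" unfolding p q .
  have "v \<sqinter> (w \<sqinter> v) = v"
  proof -
    \<comment> \<open>In \<open>v \<sqinter> w \<sqinter> v\<close> the block \<open>q \<sqinter> x \<sqinter> p\<close> occurs twice in a row; contracting it leaves \<open>v \<sqinter> v\<close>.\<close>
    have "v \<sqinter> (w \<sqinter> v)
      = (x \<sqinter> p \<sqinter> x) \<sqinter> ((q \<sqinter> (x \<sqinter> p)) \<sqinter> (q \<sqinter> (x \<sqinter> p))) \<sqinter> (x \<sqinter> q \<sqinter> x)"
      unfolding v_def w_def using c by (simp only: meet_assoc closed meet_idem_left)
    also have "\<dots> = (x \<sqinter> p \<sqinter> x) \<sqinter> (q \<sqinter> (x \<sqinter> p)) \<sqinter> (x \<sqinter> q \<sqinter> x)"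
      using c by (subst meet_idem[of "q \<sqinter> (x \<sqinter> p)"]) simp_all
    also have "\<dots> = v \<sqinter> v"
      unfolding v_def using c by (simp only: meet_assoc closed meet_idem_left)
    also have "\<dots> = v" by (rule meet_idem) (simp add: d)
    finally show ?thesis .
  qed
  then have "v = w" using vw w by simp
  then show ?thesis by (simp add: v_def w_def)
qed

lemma meet_normal_same:
  assumes c: "x \<in> carrier S" "y \<in> carrier S" "z \<in> carrier S"
  shows "x \<sqinter> (y \<sqinter> (z \<sqinter> x)) = x \<sqinter> (z \<sqinter> (y \<sqinter> x))"
proof -
  have "(x \<sqinter> y \<sqinter> x) \<sqinter> (x \<sqinter> z \<sqinter> x) = (x \<sqinter> z \<sqinter> x) \<sqinter> (x \<sqinter> y \<sqinter> x)"
    by (rule meet_commute_below[of x]) (use c in \<open>simp_all add: meet_assoc\<close>)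
  then have "x \<sqinter> (y \<sqinter> (x \<sqinter> (z \<sqinter> x))) = x \<sqinter> (z \<sqinter> (x \<sqinter> (y \<sqinter> x)))"
    using c by (simp add: meet_assoc)
  then show ?thesis using c by (simp add: meet_insert_middle)
qed

text \<open>The outer factors \<open>x\<close> and \<open>w\<close> can be made equal: squaring the product puts an \<open>x\<close> behind \<open>w\<close>,
  and a \<open>w\<close> in front of \<open>x\<close>, so that the case of equal outer factors applies.\<close>

lemma meet_normal:
  assumes c: "x \<in> carrier S" "y \<in> carrier S" "z \<in> carrier S" "w \<in> carrier S"
  shows "x \<sqinter> (y \<sqinter> (z \<sqinter> w)) = x \<sqinter> (z \<sqinter> (y \<sqinter> w))"
proof -
  let ?u = "x \<sqinter> (y \<sqinter> (z \<sqinter> w))" and ?v = "x \<sqinter> (z \<sqinter> (y \<sqinter> w))"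
  have xz: "x \<sqinter> (y \<sqinter> (z \<sqinter> (w \<sqinter> x))) = x \<sqinter> (z \<sqinter> (y \<sqinter> (w \<sqinter> x)))"
  proof -
    have "x \<sqinter> (y \<sqinter> (z \<sqinter> (w \<sqinter> x))) = (x \<sqinter> (y \<sqinter> (z \<sqinter> x))) \<sqinter> (w \<sqinter> x)"
      using meet_insert_middle[of x "y \<sqinter> z" w] c by (simp add: meet_assoc)
    also have "\<dots> = (x \<sqinter> (z \<sqinter> (y \<sqinter> x))) \<sqinter> (w \<sqinter> x)"
      using meet_normal_same[of x y z] c by simp
    also have "\<dots> = x \<sqinter> (z \<sqinter> (y \<sqinter> (w \<sqinter> x)))"
      using meet_insert_middle[of x "z \<sqinter> y" w] c by (simp add: meet_assoc)
    finally show ?thesis .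
  qed
  have wz: "w \<sqinter> (x \<sqinter> (y \<sqinter> (z \<sqinter> w))) = w \<sqinter> (x \<sqinter> (z \<sqinter> (y \<sqinter> w)))"
    using meet_insert_middle[of w x "y \<sqinter> z"] meet_insert_middle[of w x "z \<sqinter> y"]
      meet_normal_same[of w y z] c by (simp add: meet_assoc)
  have "?u = ?u \<sqinter> ?u" using c by (intro meet_idem[symmetric]) simp
  also have "\<dots> = (x \<sqinter> (y \<sqinter> (z \<sqinter> (w \<sqinter> x)))) \<sqinter> (y \<sqinter> (z \<sqinter> w))"
    using c by (simp only: meet_assoc closed)
  also have "\<dots> = (x \<sqinter> (z \<sqinter> y)) \<sqinter> (w \<sqinter> (x \<sqinter> (y \<sqinter> (z \<sqinter> w))))"
    unfolding xz using c by (simp only: meet_assoc closed)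
  also have "\<dots> = ?v \<sqinter> ?v" unfolding wz using c by (simp only: meet_assoc closed)
  also have "\<dots> = ?v" using c by (intro meet_idem) simp
  finally show ?thesis .
qed

section \<open>Orthogonality and relative complements\<close>

lemma meet_zero_middle:
  assumes c: "x \<in> carrier S" "y \<in> carrier S" "z \<in> carrier S" and "x \<sqinter> z = \<zero>"
  shows "x \<sqinter> (y \<sqinter> z) = \<zero>"
proof -
  have "x \<sqinter> (y \<sqinter> z) = x \<sqinter> (y \<sqinter> (z \<sqinter> z))" using c by simp
  also have "\<dots> = (x \<sqinter> z) \<sqinter> (y \<sqinter> z)" using c by (simp only: meet_normal meet_assoc closed)
  finally show ?thesis using assms by (simp add: zero_meet)
qed

lemma meet_zero_commute:
  assumes c: "x \<in> carrier S" "y \<in> carrier S" and "x \<sqinter> y = \<zero>"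
  shows "y \<sqinter> x = \<zero>"
proof -
  have "y \<sqinter> x = y \<sqinter> (x \<sqinter> y) \<sqinter> x" using c by (simp add: meet_assoc)
  then show ?thesis using assms by (simp add: zero_meet meet_zero)
qed

text \<open>The product \<open>(x \<squnion> y) \<sqinter> (y \<squnion> x)\<close>, expanded by the two distributive laws, yields either side.\<close>

lemma join_commute_orthogonal:
  assumes c: "x \<in> carrier S" "y \<in> carrier S" and o: "x \<sqinter> y = \<zero>"
  shows "x \<squnion> y = y \<squnion> x"
proof -
  have o': "y \<sqinter> x = \<zero>" using meet_zero_commute assms by blast
  have "(x \<squnion> y) \<sqinter> (y \<squnion> x) = (x \<sqinter> (y \<squnion> x)) \<squnion> (y \<sqinter> (y \<squnion> x))"
    using c by (simp add: join_meet_distrib)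
  also have "\<dots> = x \<squnion> y"
    using c o o' by (simp add: meet_join_distrib zero_join join_zero)
  finally have 1: "(x \<squnion> y) \<sqinter> (y \<squnion> x) = x \<squnion> y" .
  have "(x \<squnion> y) \<sqinter> (y \<squnion> x) = ((x \<squnion> y) \<sqinter> y) \<squnion> ((x \<squnion> y) \<sqinter> x)"
    using c by (intro meet_join_distrib) simp_all
  also have "\<dots> = y \<squnion> x"
    using c o o' by (simp add: join_meet_distrib zero_join join_zero)
  finally show ?thesis using 1 by simp
qed

text \<open>Both complements of \<open>x \<sqinter> y \<sqinter> x\<close> equal their meet, by distributivity, as complements in a
  distributive lattice do.\<close>

lemma diff_unique:
  assumes c: "x \<in> carrier S" "y \<in> carrier S" "d \<in> carrier S"
    and j: "(x \<sqinter> y \<sqinter> x) \<squnion> d = x" and m: "(x \<sqinter> y \<sqinter> x) \<sqinter> d = \<zero>"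
  shows "x \<setminus> y = d"
proof -
  let ?c = "x \<sqinter> y \<sqinter> x" and ?d = "x \<setminus> y"
  have m': "d \<sqinter> ?c = \<zero>" by (rule meet_zero_commute[OF _ _ m]) (use c in simp_all)
  have below: "x \<sqinter> e = e" "e \<sqinter> x = e"
    if "e \<in> carrier S" "?c \<squnion> e = x" "?c \<sqinter> e = \<zero>" "e \<sqinter> ?c = \<zero>" for e
  proof -
    show "x \<sqinter> e = e" using meet_absorb_right[of e ?c] that c by simp
    have "e \<sqinter> (?c \<squnion> e) = (e \<sqinter> ?c) \<squnion> (e \<sqinter> e)"
      using that c by (intro meet_join_distrib) simp_all
    then show "e \<sqinter> x = e" using that by (simp add: zero_join)
  qed
  have dc: "?d \<in> carrier S" and c': "?c \<in> carrier S" using c by simp_all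
  have D: "?c \<squnion> ?d = x" "?c \<sqinter> ?d = \<zero>" "?d \<sqinter> ?c = \<zero>"
    using c by (intro diff_join meet_diff diff_meet; simp)+
  have "?d = ?d \<sqinter> (?c \<squnion> d)" using below[OF dc] D j by simp
  also have "\<dots> = ?d \<sqinter> d" using D dc c c' by (simp only: meet_join_distrib zero_join closed)
  finally have 1: "?d = ?d \<sqinter> d" .
  have "d = (?c \<squnion> ?d) \<sqinter> d" using below[OF c(3) j m m'] D by simp
  also have "\<dots> = ?d \<sqinter> d" using m dc c c' by (simp only: join_meet_distrib zero_join closed)
  finally show ?thesis using 1 by simp
qed

lemma diff_below:
  assumes c: "x \<in> carrier S" "y \<in> carrier S"
  shows "x \<sqinter> (x \<setminus> y) = x \<setminus> y" "(x \<setminus> y) \<sqinter> x = x \<setminus> y"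
proof -
  show 1: "x \<sqinter> (x \<setminus> y) = x \<setminus> y"
    using meet_absorb_right[of "x \<setminus> y" "x \<sqinter> y \<sqinter> x"] c by (simp add: diff_join)
  have "(x \<setminus> y) \<sqinter> ((x \<sqinter> y \<sqinter> x) \<squnion> (x \<setminus> y)) = x \<setminus> y" using c
    by (simp only: meet_join_distrib diff_meet zero_join closed meet_idem)
  then show "(x \<setminus> y) \<sqinter> x = x \<setminus> y" using c by (simp add: diff_join)
qed

lemma diff_orthogonal:
  assumes c: "x \<in> carrier S" "y \<in> carrier S"
  shows "(x \<setminus> y) \<sqinter> y = \<zero>"
proof -
  have "(x \<setminus> y) \<sqinter> y = (x \<setminus> y) \<sqinter> (y \<sqinter> ((x \<setminus> y) \<sqinter> y))" using c by simp
  also have "\<dots> = ((x \<setminus> y) \<sqinter> x) \<sqinter> (y \<sqinter> ((x \<sqinter> (x \<setminus> y)) \<sqinter> y))" using c by (simp only: diff_below)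
  also have "\<dots> = ((x \<setminus> y) \<sqinter> (x \<sqinter> y \<sqinter> x)) \<sqinter> ((x \<setminus> y) \<sqinter> y)" using c
    by (simp only: meet_assoc closed)
  also have "\<dots> = \<zero>" using c by (simp add: diff_meet zero_meet)
  finally show ?thesis .
qed

section \<open>The direct decomposition along an element\<close>

text \<open>The principal ideal of \<open>e\<close>: the defining equation says that the class of \<open>a\<close> lies below that
  of \<open>e\<close> in the generalized Boolean algebra of equivalence classes, which is weaker than \<open>a\<close>
  lying below \<open>e\<close>.\<close>

definition covered :: "'a \<Rightarrow> 'a set" where
  "covered e = {a \<in> carrier S. a \<sqinter> e \<sqinter> a = a}"

definition annihilator :: "'a \<Rightarrow> 'a set" where
  "annihilator e = {b \<in> carrier S. b \<sqinter> e = \<zero>}"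

lemma covered_meet:
  assumes e: "e \<in> carrier S" and a: "a \<in> covered e" and t: "t \<in> carrier S"
  shows "a \<sqinter> t \<in> covered e" "t \<sqinter> a \<in> covered e"
proof -
  have c: "a \<in> carrier S" and ae: "a \<sqinter> (e \<sqinter> a) = a"
    using a e by (auto simp: covered_def meet_assoc)
  have "(a \<sqinter> t) \<sqinter> e \<sqinter> (a \<sqinter> t) = a \<sqinter> (e \<sqinter> (t \<sqinter> (a \<sqinter> t)))"
    using meet_normal[of a t e "a \<sqinter> t"] c e t by (simp only: meet_assoc closed)
  also have "\<dots> = (a \<sqinter> (e \<sqinter> a)) \<sqinter> t"
    using meet_normal[of e t a t] c e t by (simp only: meet_assoc closed meet_idem)
  finally show "a \<sqinter> t \<in> covered e" using c t by (simp add: covered_def ae)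
  have "(t \<sqinter> a) \<sqinter> e \<sqinter> (t \<sqinter> a) = t \<sqinter> (a \<sqinter> (t \<sqinter> (e \<sqinter> a)))"
    using meet_normal[of a e t a] c e t by (simp only: meet_assoc closed)
  also have "\<dots> = t \<sqinter> (a \<sqinter> (e \<sqinter> a))" using meet_normal[of t a t "e \<sqinter> a"] c e t by simp
  finally show "t \<sqinter> a \<in> covered e" using c t by (simp add: covered_def ae)
qed

text \<open>Needed for joins: it makes \<open>(a \<squnion> b) \<sqinter> e \<sqinter> (a \<squnion> b)\<close> expand exactly as
  \<open>(a \<squnion> b) \<sqinter> (a \<squnion> b)\<close> does.\<close>

lemma meet_covered_middle:
  assumes e: "e \<in> carrier S" and a: "a \<in> covered e" "b \<in> covered e"
  shows "a \<sqinter> (e \<sqinter> b) = a \<sqinter> b"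
proof -
  have c: "a \<in> carrier S" "b \<in> carrier S" and ae: "a \<sqinter> (e \<sqinter> a) = a" "b \<sqinter> (e \<sqinter> b) = b"
    using a e by (auto simp: covered_def meet_assoc)
  have "a \<sqinter> b = (a \<sqinter> (e \<sqinter> a)) \<sqinter> b" by (simp add: ae)
  also have "\<dots> = a \<sqinter> (a \<sqinter> (e \<sqinter> b))" using c e meet_normal[of a e a b] by (simp only: meet_assoc closed)
  finally show ?thesis using c e by simp
qed

lemma covered_join:
  assumes e: "e \<in> carrier S" and a: "a \<in> covered e" "b \<in> covered e"
  shows "a \<squnion> b \<in> covered e"
proof -
  have c: "a \<in> carrier S" "b \<in> carrier S" using a by (auto simp: covered_def)
  have "(a \<squnion> b) \<sqinter> e \<sqinter> (a \<squnion> b) = (a \<squnion> b) \<sqinter> (a \<squnion> b)"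
    using c e by (simp only: join_meet_distrib meet_join_distrib meet_assoc closed
        meet_covered_middle[OF e] a)
  then show ?thesis using c by (simp add: covered_def)
qed

lemma covered_diff:
  assumes e: "e \<in> carrier S" and a: "a \<in> covered e" and t: "t \<in> carrier S"
  shows "a \<setminus> t \<in> covered e"
proof -
  have "a \<in> carrier S" using a by (simp add: covered_def)
  then show ?thesis using covered_meet(1)[OF e a, of "a \<setminus> t"] t by (simp add: diff_below)
qed

lemma annihilator_meet:
  assumes e: "e \<in> carrier S" and b: "b \<in> annihilator e" and t: "t \<in> carrier S"
  shows "b \<sqinter> t \<in> annihilator e" "t \<sqinter> b \<in> annihilator e"
  using assms meet_zero_middle[of b t e] by (simp_all add: annihilator_def meet_assoc meet_zero)

lemma annihilator_join:
  assumes e: "e \<in> carrier S" and b: "b \<in> annihilator e" "c \<in> annihilator e"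
  shows "b \<squnion> c \<in> annihilator e"
  using assms by (simp add: annihilator_def join_meet_distrib zero_join)

lemma annihilator_diff:
  assumes e: "e \<in> carrier S" and b: "b \<in> annihilator e" and t: "t \<in> carrier S"
  shows "b \<setminus> t \<in> annihilator e"
proof -
  have "b \<in> carrier S" using b by (simp add: annihilator_def)
  then show ?thesis using annihilator_meet(1)[OF e b, of "b \<setminus> t"] t by (simp add: diff_below)
qed

lemma covered_annihilator_orthogonal:
  assumes e: "e \<in> carrier S" and a: "a \<in> covered e" and b: "b \<in> annihilator e"
  shows "a \<sqinter> b = \<zero>" "b \<sqinter> a = \<zero>"
proof -
  have c: "a \<in> carrier S" "b \<in> carrier S" and ae: "a \<sqinter> (e \<sqinter> a) = a" and be: "b \<sqinter> e = \<zero>"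
    using a b e by (auto simp: covered_def annihilator_def meet_assoc)
  have "b \<sqinter> a = b \<sqinter> (a \<sqinter> (e \<sqinter> a))" by (simp add: ae)
  also have "\<dots> = (b \<sqinter> a \<sqinter> e) \<sqinter> a" using c e by (simp add: meet_assoc)
  also have "\<dots> = \<zero>" using c e meet_zero_middle[of b a e] be by (simp add: meet_assoc zero_meet)
  finally show "b \<sqinter> a = \<zero>" .
  then show "a \<sqinter> b = \<zero>" by (rule meet_zero_commute[rotated 2]) (rule c)+
qed

lemma decomposition_exists:
  assumes e: "e \<in> carrier S" and z: "z \<in> carrier S"
  obtains a b where "a \<in> covered e" "b \<in> annihilator e" "z = a \<squnion> b"
proof
  show "z \<sqinter> e \<sqinter> z \<in> covered e" using e z by (simp add: covered_def meet_assoc)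
  show "z \<setminus> e \<in> annihilator e" using e z by (simp add: annihilator_def diff_orthogonal)
  show "z = (z \<sqinter> e \<sqinter> z) \<squnion> (z \<setminus> e)" using e z by (simp add: diff_join)
qed

lemma decomposition_unique:
  assumes e: "e \<in> carrier S" and a: "a \<in> covered e" and b: "b \<in> annihilator e"
  shows "(a \<squnion> b) \<sqinter> e \<sqinter> (a \<squnion> b) = a" "(a \<squnion> b) \<setminus> e = b"
proof -
  have c: "a \<in> carrier S" "b \<in> carrier S" and ae: "a \<sqinter> (e \<sqinter> a) = a" and be: "b \<sqinter> e = \<zero>"
    using a b e by (auto simp: covered_def annihilator_def meet_assoc)
  note o = covered_annihilator_orthogonal[OF e a b]
  have eb: "e \<sqinter> b = \<zero>" using meet_zero_commute[of b e] be c e by simp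
  have "(a \<squnion> b) \<sqinter> e \<sqinter> (a \<squnion> b) = (a \<sqinter> e) \<sqinter> (a \<squnion> b)"
    using c e by (simp add: join_meet_distrib be join_zero)
  also have "\<dots> = a" using c e
    by (simp add: meet_join_distrib meet_assoc ae eb meet_zero join_zero)
  finally show 1: "(a \<squnion> b) \<sqinter> e \<sqinter> (a \<squnion> b) = a" .
  show "(a \<squnion> b) \<setminus> e = b" by (rule diff_unique) (use c e o in \<open>simp_all add: 1\<close>)
qed

text \<open>Mixed meets vanish by orthogonality, which gives the meet, and orthogonal elements commute under
  join, which gives the join. The difference follows because it is the unique complement: the
  componentwise difference has the two properties required of it.\<close>

lemma componentwise:
  assumes e: "e \<in> carrier S" and a: "a \<in> covered e" "a' \<in> covered e"
    and b: "b \<in> annihilator e" "b' \<in> annihilator e"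
  shows meet_componentwise: "(a \<squnion> b) \<sqinter> (a' \<squnion> b') = (a \<sqinter> a') \<squnion> (b \<sqinter> b')"
    and join_componentwise: "(a \<squnion> b) \<squnion> (a' \<squnion> b') = (a \<squnion> a') \<squnion> (b \<squnion> b')"
    and diff_componentwise: "(a \<squnion> b) \<setminus> (a' \<squnion> b') = (a \<setminus> a') \<squnion> (b \<setminus> b')"
proof -
  have c: "a \<in> carrier S" "a' \<in> carrier S" "b \<in> carrier S" "b' \<in> carrier S"
    using a b by (auto simp: covered_def annihilator_def)
  have meet: "(x \<squnion> y) \<sqinter> (x' \<squnion> y') = (x \<sqinter> x') \<squnion> (y \<sqinter> y')"
    if x: "x \<in> covered e" "x' \<in> covered e" and y: "y \<in> annihilator e" "y' \<in> annihilator e"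
    for x x' y y'
  proof -
    have d: "x \<in> carrier S" "x' \<in> carrier S" "y \<in> carrier S" "y' \<in> carrier S"
      using x y by (auto simp: covered_def annihilator_def)
    note o = covered_annihilator_orthogonal[OF e x(1) y(2)]
      covered_annihilator_orthogonal[OF e x(2) y(1)]
    show ?thesis using d
      by (simp add: join_meet_distrib meet_join_distrib o join_zero zero_join)
  qed
  have join: "(x \<squnion> y) \<squnion> (x' \<squnion> y') = (x \<squnion> x') \<squnion> (y \<squnion> y')"
    if x: "x \<in> covered e" "x' \<in> covered e" and y: "y \<in> annihilator e" "y' \<in> annihilator e"
    for x x' y y'
  proof -
    have d: "x \<in> carrier S" "x' \<in> carrier S" "y \<in> carrier S" "y' \<in> carrier S"
      using x y by (auto simp: covered_def annihilator_def)
    have "y \<squnion> x' = x' \<squnion> y" using d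
      by (intro join_commute_orthogonal covered_annihilator_orthogonal[OF e x(2) y(1)])
    then have "x \<squnion> ((y \<squnion> x') \<squnion> y') = x \<squnion> ((x' \<squnion> y) \<squnion> y')" by simp
    then show ?thesis using d by (simp add: join_assoc)
  qed
  show "(a \<squnion> b) \<sqinter> (a' \<squnion> b') = (a \<sqinter> a') \<squnion> (b \<sqinter> b')" using meet a b by blast
  show "(a \<squnion> b) \<squnion> (a' \<squnion> b') = (a \<squnion> a') \<squnion> (b \<squnion> b')" using join a b by blast
  have in_cov: "a \<sqinter> a' \<in> covered e" "a \<sqinter> a' \<sqinter> a \<in> covered e" "a \<setminus> a' \<in> covered e"
    using a c by (simp_all add: covered_meet[OF e] covered_diff[OF e])
  have in_ann: "b \<sqinter> b' \<in> annihilator e" "b \<sqinter> b' \<sqinter> b \<in> annihilator e" "b \<setminus> b' \<in> annihilator e"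
    using b c by (simp_all add: annihilator_meet[OF e] annihilator_diff[OF e])
  have sandwich: "(a \<squnion> b) \<sqinter> (a' \<squnion> b') \<sqinter> (a \<squnion> b) = (a \<sqinter> a' \<sqinter> a) \<squnion> (b \<sqinter> b' \<sqinter> b)"
    using a b in_cov in_ann by (simp add: meet)
  show "(a \<squnion> b) \<setminus> (a' \<squnion> b') = (a \<setminus> a') \<squnion> (b \<setminus> b')"
  proof (rule diff_unique)
    show "((a \<squnion> b) \<sqinter> (a' \<squnion> b') \<sqinter> (a \<squnion> b)) \<squnion> ((a \<setminus> a') \<squnion> (b \<setminus> b')) = a \<squnion> b"
      unfolding sandwich using c in_cov in_ann by (simp add: join diff_join)
    show "((a \<squnion> b) \<sqinter> (a' \<squnion> b') \<sqinter> (a \<squnion> b)) \<sqinter> ((a \<setminus> a') \<squnion> (b \<setminus> b')) = \<zero>"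
      unfolding sandwich using c in_cov in_ann by (simp add: meet meet_diff join_zero)
  qed (use c in simp_all)
qed

end

text \<open>The components of an element are unique and the operations act on them separately, so taking
  a component is a homomorphism.\<close>

lemma component_homs:
  fixes S :: "'a skew_algebra" (structure)
  assumes S: "skew_boolean_algebra S" and e: "e \<in> carrier S"
  shows covered_component_hom: "(\<lambda>z. z \<sqinter> e \<sqinter> z) \<in> skew_hom S S"
    and annihilator_component_hom: "(\<lambda>z. z \<setminus> e) \<in> skew_hom S S"
proof -
  interpret skew_boolean_algebra S by (rule S)
  have zero: "\<zero> \<sqinter> e \<sqinter> \<zero> = \<zero>" "\<zero> \<setminus> e = \<zero>"
    using decomposition_unique[OF e, of \<zero> \<zero>] e
    by (simp_all add: covered_def annihilator_def meet_zero zero_meet join_zero)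
  have ops: "(x \<sqinter> y) \<sqinter> e \<sqinter> (x \<sqinter> y) = (x \<sqinter> e \<sqinter> x) \<sqinter> (y \<sqinter> e \<sqinter> y) \<and> (x \<sqinter> y) \<setminus> e = (x \<setminus> e) \<sqinter> (y \<setminus> e) \<and>
    (x \<squnion> y) \<sqinter> e \<sqinter> (x \<squnion> y) = (x \<sqinter> e \<sqinter> x) \<squnion> (y \<sqinter> e \<sqinter> y) \<and> (x \<squnion> y) \<setminus> e = (x \<setminus> e) \<squnion> (y \<setminus> e) \<and>
    (x \<setminus> y) \<sqinter> e \<sqinter> (x \<setminus> y) = (x \<sqinter> e \<sqinter> x) \<setminus> (y \<sqinter> e \<sqinter> y) \<and> (x \<setminus> y) \<setminus> e = (x \<setminus> e) \<setminus> (y \<setminus> e)"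
    if xy: "x \<in> carrier S" "y \<in> carrier S" for x y
  proof -
    obtain a b where x: "a \<in> covered e" "b \<in> annihilator e" "x = a \<squnion> b"
      using decomposition_exists[OF e xy(1)] .
    obtain a' b' where y: "a' \<in> covered e" "b' \<in> annihilator e" "y = a' \<squnion> b'"
      using decomposition_exists[OF e xy(2)] .
    have c: "a' \<in> carrier S" "b' \<in> carrier S"
      using y by (auto simp: covered_def annihilator_def)
    note U = decomposition_unique[OF e]
    show ?thesis unfolding x(3) y(3)
      using x(1,2) y(1,2) c
      by (simp only: componentwise[OF e] U covered_meet[OF e] annihilator_meet[OF e]
        covered_join[OF e] annihilator_join[OF e] covered_diff[OF e] annihilator_diff[OF e] simp_thms)
  qed
  show "(\<lambda>z. z \<sqinter> e \<sqinter> z) \<in> skew_hom S S" "(\<lambda>z. z \<setminus> e) \<in> skew_hom S S"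
    using e by (auto simp: skew_hom_def zero ops)
qed

section \<open>Equivalent elements\<close>

context skew_boolean_algebra
begin

text \<open>Put \<open>c = b \<sqinter> a\<close> and \<open>d = a \<squnion> b\<close>. Absorption gives \<open>a \<sqinter> d = a\<close>, and \<open>b \<sqinter> d\<close> turns out to be \<open>c\<close>, so that
  \<open>d = (a \<squnion> b) \<sqinter> d = a \<squnion> c = c\<close>.\<close>

lemma equivalent_join:
  assumes c: "a \<in> carrier S" "b \<in> carrier S" and ab: "a \<sqinter> b \<sqinter> a = a" "b \<sqinter> a \<sqinter> b = b"
  shows "a \<squnion> b = b \<sqinter> a"
proof -
  let ?c = "b \<sqinter> a" and ?d = "a \<squnion> b"
  have ca: "a \<squnion> ?c = ?c" "?c \<squnion> b = ?c"
    using join_absorb_right[of ?c a] join_absorb_left[of ?c b] c ab by (simp_all add: meet_assoc)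
  have "b \<sqinter> ?d = ?c"
    using c ca by (simp add: meet_join_distrib)
  moreover have "a \<sqinter> ?d = a" using c by (simp add: meet_absorb_left)
  moreover have "?d = (a \<sqinter> ?d) \<squnion> (b \<sqinter> ?d)"
    using c join_meet_distrib[of a b ?d] by simp
  ultimately show ?thesis using ca by simp
qed

lemma equivalent_diff:
  assumes c: "a \<in> carrier S" "b \<in> carrier S" and ab: "a \<sqinter> b \<sqinter> a = a"
  shows "a \<setminus> b = \<zero>"
  by (rule diff_unique) (use assms in \<open>simp_all add: join_zero meet_zero\<close>)

lemma equivalent_meet_collapse:
  assumes c: "p \<in> carrier S" "q \<in> carrier S" "r \<in> carrier S" and pq: "p \<sqinter> q \<sqinter> p = p"
  shows "p \<sqinter> (q \<sqinter> r) = p \<sqinter> r"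
proof -
  have "p \<sqinter> r = (p \<sqinter> q \<sqinter> p) \<sqinter> r" by (simp only: pq)
  also have "\<dots> = p \<sqinter> (p \<sqinter> (q \<sqinter> r))" using c meet_normal[of p q p r] by (simp only: meet_assoc closed)
  finally show ?thesis using c by simp
qed

end

text \<open>A product of members of \<open>Y\<close> depends on its first and last factor only
  (\<open>equivalent_meet_collapse\<close>), joins are meets in the opposite order and differences vanish. So the
  meets of two members of \<open>Y\<close>, with zero, are closed under all operations.\<close>

lemma finite_generated_by_class:
  fixes S :: "'a skew_algebra" (structure)
  assumes S: "skew_boolean_algebra S" and Y: "finite Y" "Y \<subseteq> carrier S"
    and eq: "\<And>p q. \<lbrakk>p \<in> Y; q \<in> Y\<rbrakk> \<Longrightarrow> p \<sqinter> q \<sqinter> p = p"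
  shows "finite (generated S (insert \<zero> Y))"
proof -
  interpret skew_boolean_algebra S by (rule S)
  define N where "N = (\<lambda>(p, q). p \<sqinter> q) ` (Y \<times> Y)"
  have N: "N \<subseteq> carrier S" using Y by (auto simp: N_def intro!: meet_closed)
  have N_meet: "a \<sqinter> b \<in> N" and N_eq: "a \<sqinter> b \<sqinter> a = a" if ab: "a \<in> N" "b \<in> N" for a b
  proof -
    obtain p q r s where *: "p \<in> Y" "q \<in> Y" "r \<in> Y" "s \<in> Y" "a = p \<sqinter> q" "b = r \<sqinter> s"
      using ab by (auto simp: N_def)
    have c: "p \<in> carrier S" "q \<in> carrier S" "r \<in> carrier S" "s \<in> carrier S" using * Y by auto
    have col: "u \<sqinter> (v \<sqinter> w) = u \<sqinter> w" if "u \<in> Y" "v \<in> Y" "w \<in> carrier S" for u v w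
      using that Y eq by (intro equivalent_meet_collapse) auto
    have "a \<sqinter> b = p \<sqinter> s" using * c by (simp add: meet_assoc col)
    then show "a \<sqinter> b \<in> N" using * by (auto simp: N_def)
    show "a \<sqinter> b \<sqinter> a = a" using * c by (simp add: meet_assoc col)
  qed
  have "g \<in> insert \<zero> N" if "g \<in> generated S (insert \<zero> Y)" for g
    using that
  proof induction
    case (gen_incl y)
    then show ?case using Y by (auto simp: N_def image_iff) (metis meet_idem subsetD)
  next
    case (gen_meet x y)
    then show ?case using N N_meet by (auto simp: zero_meet meet_zero)
  next
    case (gen_join x y)
    then show ?case using N N_meet N_eq equivalent_join[of x y]
      by (auto simp: zero_join join_zero subset_iff)
  next
    case (gen_diff x y)
    have "x \<setminus> \<zero> = x" if "x \<in> carrier S" for x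
      by (rule diff_unique) (use that in \<open>simp_all add: meet_zero zero_meet zero_join\<close>)
    moreover have "\<zero> \<setminus> y = \<zero>" if "y \<in> carrier S" for y
      by (rule diff_unique) (use that in \<open>simp_all add: meet_zero zero_meet zero_join\<close>)
    ultimately show ?case using gen_diff N N_eq equivalent_diff[of x y]
      by (auto simp: subset_iff)
  qed simp
  then have "generated S (insert \<zero> Y) \<subseteq> insert \<zero> N" by blast
  moreover have "finite N" using Y by (simp add: N_def)
  ultimately show ?thesis using finite_subset by auto
qed

section \<open>Finitely generated algebras are finite\<close>

lemma generated_subset_carrier:
  fixes S :: "'a skew_algebra" (structure)
  assumes S: "skew_boolean_algebra S" and Y: "Y \<subseteq> carrier S"
  shows "generated S Y \<subseteq> carrier S"
proof
  interpret skew_boolean_algebra S by (rule S)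
  fix g assume "g \<in> generated S Y"
  then show "g \<in> carrier S" by induction (use Y in auto)
qed

lemma skew_hom_image_generated:
  fixes S :: "'a skew_algebra" (structure)
  assumes S: "skew_boolean_algebra S" and h: "h \<in> skew_hom S T" and Y: "Y \<subseteq> carrier S"
  shows "h ` generated S Y = generated T (h ` Y)"
proof
  have sub: "g \<in> carrier S" if "g \<in> generated S Y" for g
    using generated_subset_carrier[OF S Y] that by blast
  show "h ` generated S Y \<subseteq> generated T (h ` Y)"
  proof safe
    fix g assume "g \<in> generated S Y"
    then show "h g \<in> generated T (h ` Y)"
      by induction (use h in \<open>auto simp: skew_hom_def sub intro: generated.intros\<close>)
  qed
  show "generated T (h ` Y) \<subseteq> h ` generated S Y"
  proof
    fix g assume "g \<in> generated T (h ` Y)"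
    then show "g \<in> h ` generated S Y"
    proof induction
      case (gen_incl y)
      then show ?case by (auto intro: generated.intros)
    next
      case gen_zero
      have "\<zero>\<^bsub>T\<^esub> = h \<zero>" using h by (simp add: skew_hom_def)
      then show ?case by (auto intro: generated.intros)
    next
      case (gen_meet x y)
      then obtain a b where *: "a \<in> generated S Y" "b \<in> generated S Y" "x = h a" "y = h b" by blast
      then have "x \<sqinter>\<^bsub>T\<^esub> y = h (a \<sqinter> b)" using h by (simp add: skew_hom_def sub)
      then show ?case using * by (auto intro: generated.intros)
    next
      case (gen_join x y)
      then obtain a b where *: "a \<in> generated S Y" "b \<in> generated S Y" "x = h a" "y = h b" by blast
      then have "x \<squnion>\<^bsub>T\<^esub> y = h (a \<squnion> b)" using h by (simp add: skew_hom_def sub)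
      then show ?case using * by (auto intro: generated.intros)
    next
      case (gen_diff x y)
      then obtain a b where *: "a \<in> generated S Y" "b \<in> generated S Y" "x = h a" "y = h b" by blast
      then have "x \<setminus>\<^bsub>T\<^esub> y = h (a \<setminus> b)" using h by (simp add: skew_hom_def sub)
      then show ?case using * by (auto intro: generated.intros)
    qed
  qed
qed

text \<open>The set \<open>Y\<close> contains the generators that are not yet known to be mapped to zero or to a maximal
  element of the image of \<open>h\<close>. Composing \<open>h\<close> with the two projections along \<open>h y\<close> settles \<open>y\<close> and
  keeps settled generators settled, since both conditions are preserved by homomorphisms. As
  \<open>h z = (h z \<sqinter> h y \<sqinter> h z) \<squnion> (h z \<setminus> h y)\<close>, the image of \<open>h\<close> is finite if both composites have
  finite image. For empty \<open>Y\<close>, the nonzero images of generators are pairwise equivalent.\<close>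

lemma finite_hom_image:
  fixes S :: "'a skew_algebra" (structure)
  assumes S: "skew_boolean_algebra S" and X: "finite X" "X \<subseteq> carrier S" "generated S X = carrier S"
    and Y: "finite Y" "Y \<subseteq> X"
    and h: "h \<in> skew_hom S S"
    and full: "\<And>x. x \<in> X - Y \<Longrightarrow> h x = \<zero> \<or> (\<forall>z\<in>carrier S. h z \<sqinter> h x \<sqinter> h z = h z)"
  shows "finite (h ` carrier S)"
  using Y h full
proof (induction Y arbitrary: h)
  case empty
  let ?Y = "h ` X - {\<zero>}"
  have hS: "h z \<in> carrier S" if "z \<in> carrier S" for z
    using empty.prems(2) that by (auto simp: skew_hom_def)
  have "finite (generated S (insert \<zero> ?Y))"
    by (rule finite_generated_by_class[OF S]) (use X hS empty.prems in blast)+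
  moreover have "h ` carrier S = generated S (h ` X)"
    using skew_hom_image_generated[OF S empty.prems(2) X(2)] X(3) by simp
  moreover have "generated S A \<subseteq> generated S B" if "A \<subseteq> B" for A B
  proof
    fix g assume "g \<in> generated S A"
    then show "g \<in> generated S B" by induction (use that in \<open>auto intro: generated.intros\<close>)
  qed
  from this[of "h ` X" "insert \<zero> ?Y"] have "generated S (h ` X) \<subseteq> generated S (insert \<zero> ?Y)" by blast
  ultimately show ?case using finite_subset by simp
next
  case (insert y Y)
  interpret skew_boolean_algebra S by (rule S)
  define e where "e = h y"
  have hS: "h z \<in> carrier S" if "z \<in> carrier S" for z
    using insert.prems(2) that by (auto simp: skew_hom_def)
  have y: "y \<in> carrier S" using insert.prems(1) X(2) by auto
  then have e: "e \<in> carrier S" using hS by (simp add: e_def)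
  have step: "finite ((f \<circ> h) ` carrier S)"
    if f: "f \<in> skew_hom S S" and fy: "f e = \<zero> \<or> (\<forall>z\<in>carrier S. f z \<sqinter> f e \<sqinter> f z = f z)" for f
  proof (rule insert.IH)
    show "Y \<subseteq> X" using insert.prems(1) by simp
    show "f \<circ> h \<in> skew_hom S S" by (rule skew_hom_comp[OF insert.prems(2) f])
    fix x assume x: "x \<in> X - Y"
    have fm: "f (u \<sqinter> v) = f u \<sqinter> f v" "f \<zero> = \<zero>" if "u \<in> carrier S" "v \<in> carrier S" for u v
      using f that by (auto simp: skew_hom_def)
    show "(f \<circ> h) x = \<zero> \<or> (\<forall>z\<in>carrier S. (f \<circ> h) z \<sqinter> (f \<circ> h) x \<sqinter> (f \<circ> h) z = (f \<circ> h) z)"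
    proof (cases "x = y")
      case True
      then show ?thesis using fy hS by (auto simp: e_def)
    next
      case False
      then have "h x = \<zero> \<or> (\<forall>z\<in>carrier S. h z \<sqinter> h x \<sqinter> h z = h z)"
        using insert.prems(3) x by blast
      then show ?thesis
      proof
        assume "h x = \<zero>"
        then show ?thesis using fm(2)[of \<zero> \<zero>] by simp
      next
        assume *: "\<forall>z\<in>carrier S. h z \<sqinter> h x \<sqinter> h z = h z"
        have "f (h z) \<sqinter> f (h x) \<sqinter> f (h z) = f (h z)" if "z \<in> carrier S" for z
        proof -
          have "f (h z \<sqinter> h x \<sqinter> h z) = f (h z)" using * that by simp
          moreover have "h x \<in> carrier S" using x X(2) hS by blast
          ultimately show ?thesis using that hS by (simp add: fm(1))
        qed
        then show ?thesis by simp
      qed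
    qed
  qed
  let ?f = "\<lambda>z. z \<sqinter> e \<sqinter> z" and ?g = "\<lambda>z. z \<setminus> e"
  have "finite ((?f \<circ> h) ` carrier S)"
    by (rule step[OF covered_component_hom[OF S e]]) (use e in \<open>simp add: meet_assoc\<close>)
  moreover have "finite ((?g \<circ> h) ` carrier S)"
    by (rule step[OF annihilator_component_hom[OF S e]]) (use e in \<open>simp add: equivalent_diff\<close>)
  moreover have "h ` carrier S \<subseteq> (\<lambda>(a, b). a \<squnion> b) ` ((?f \<circ> h) ` carrier S \<times> (?g \<circ> h) ` carrier S)"
  proof
    fix w assume "w \<in> h ` carrier S"
    then obtain z where z: "z \<in> carrier S" "w = h z" by blast
    have "w = ?f (h z) \<squnion> ?g (h z)" using z hS e by (simp add: diff_join)
    then show "w \<in> (\<lambda>(a, b). a \<squnion> b) ` ((?f \<circ> h) ` carrier S \<times> (?g \<circ> h) ` carrier S)"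
      using z(1) by force
  qed
  ultimately show ?case by (meson finite_SigmaI finite_imageI finite_subset)
qed

lemma finitely_generated_finite:
  fixes S :: "'a skew_algebra"
  assumes "skew_boolean_algebra S" and "finite X" and "generating_set S X"
  shows "finite (carrier S)"
proof -
  have "(\<lambda>x. x) \<in> skew_hom S S" by (auto simp: skew_hom_def)
  then have "finite ((\<lambda>x. x) ` carrier S)"
    using assms by (intro finite_hom_image[of S X X]) (auto simp: generating_set_def)
  then show ?thesis by simp
qed

section \<open>Cardinality of generating sets\<close>

lemma skew_hom_eq_on_generated:
  fixes S :: "'a skew_algebra"
  assumes S: "skew_boolean_algebra S" and Y: "Y \<subseteq> carrier S"
    and h: "h \<in> skew_hom S T" "k \<in> skew_hom S T" "\<And>y. y \<in> Y \<Longrightarrow> h y = k y"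
    and g: "g \<in> generated S Y"
  shows "h g = k g"
proof -
  have sub: "g \<in> carrier S" if "g \<in> generated S Y" for g
    using generated_subset_carrier[OF S Y] that by blast
  show ?thesis using g by induction (use h in \<open>auto simp: skew_hom_def sub\<close>)
qed

text \<open>The subset \<open>A\<close> of \<open>X\<close> corresponds to the homomorphism \<open>h A\<close> to the two-element algebra that is
  nonzero on exactly the members of \<open>A\<close> among those of \<open>X\<close>. Recording where \<open>h A\<close> is nonzero on
  \<open>Z\<close> embeds the subsets of \<open>X\<close> into those of \<open>Z\<close>.\<close>

lemma free_generators_le_generating_set:
  fixes S :: "'a skew_algebra"
  assumes X: "finite X" and S: "free_on V S X" and Z: "generating_set S Z" "finite Z"
  shows "card X \<le> card Z"
proof -
  define T :: "bool skew_algebra" where "T = \<lparr>carrier = {False, True},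
    meet = \<lambda>x y. if x = False then False else y, join = \<lambda>x y. if x = False then y else x,
    diff = \<lambda>x y. if y = False then x else False, zero = False\<rparr>"
  have T: "in_variety V T" unfolding T_def by (rule two_element_algebra[of True False]) simp
  have "\<exists>h. h \<in> skew_hom S T \<and> (\<forall>x\<in>X. h x = (x \<in> A))" for A
  proof -
    have "(\<lambda>x. x \<in> A) ` X \<subseteq> carrier T" by (auto simp: T_def)
    from free_on_universal[OF S T this] show ?thesis by blast
  qed
  then obtain h where "\<forall>A. h A \<in> skew_hom S T \<and> (\<forall>x\<in>X. h A x = (x \<in> A))"
    using choice[of "\<lambda>A h. h \<in> skew_hom S T \<and> (\<forall>x\<in>X. h x = (x \<in> A))"] by blast
  then have h: "h A \<in> skew_hom S T" "x \<in> X \<Longrightarrow> h A x \<longleftrightarrow> x \<in> A" for A x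
    by simp_all
  have sba: "skew_boolean_algebra S" and XS: "X \<subseteq> carrier S"
    using S in_variety_sba by (auto simp: free_on_def generating_set_def)
  have "inj_on (\<lambda>A. {z \<in> Z. h A z}) (Pow X)"
  proof (rule inj_onI)
    fix A B assume AB: "A \<in> Pow X" "B \<in> Pow X" "{z \<in> Z. h A z} = {z \<in> Z. h B z}"
    have "h A x = h B x" if "x \<in> X" for x
    proof (rule skew_hom_eq_on_generated[OF sba _ h(1) h(1)])
      show "Z \<subseteq> carrier S" "x \<in> generated S Z" using Z that XS by (auto simp: generating_set_def)
    qed (use AB(3) in blast)
    then show "A = B" using AB(1,2) h(2) by blast
  qed
  then have "card (Pow X) \<le> card (Pow Z)"
    by (rule card_inj_on_le) (use Z in auto)
  then show ?thesis using X Z by (simp add: card_Pow)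
qed

section \<open>Transport of freeness\<close>

lemma skew_hom_inverse:
  fixes S :: "'a skew_algebra"
  assumes S: "skew_boolean_algebra S" and h: "h \<in> skew_hom S T" "bij_betw h (carrier S) (carrier T)"
  shows "inv_into (carrier S) h \<in> skew_hom T S"
proof -
  interpret skew_boolean_algebra S by (rule S)
  let ?k = "inv_into (carrier S) h"
  have kh: "?k (h x) = x" if "x \<in> carrier S" for x
    using h(2) that by (simp add: bij_betw_def)
  have hom: "h (zero S) = zero T" "h (meet S x y) = meet T (h x) (h y)"
    "h (join S x y) = join T (h x) (h y)" "h (diff S x y) = diff T (h x) (h y)"
    if "x \<in> carrier S" "y \<in> carrier S" for x y
    using h(1) that by (auto simp: skew_hom_def)
  have T: "carrier T = h ` carrier S" using h(2) by (simp add: bij_betw_def)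
  show ?thesis unfolding skew_hom_def T
    by (auto simp: kh hom[symmetric]) (metis hom(1) kh zero_closed)
qed

theorem theorem5p2:
  fixes V :: sba_variety and S :: "'a skew_algebra" and X :: "'a set"
  assumes "finite X" and "X \<noteq> {}" and "free_on V S X"
  shows "minimal_generating_set S X \<and>
    (\<forall>Y. minimal_generating_set S Y \<longrightarrow> free_on V S Y)"
proof (intro conjI allI impI)
  have V: "in_variety V S" and gen: "generating_set S X" and X: "X \<subseteq> carrier S"
    using assms(3) by (auto simp: free_on_def generating_set_def)
  have sba: "skew_boolean_algebra S" using V by (rule in_variety_sba)
  have fin: "finite (carrier S)" using finitely_generated_finite[OF sba assms(1) gen] .
  have fin_gen: "finite Z" if "generating_set S Z" for Z
    using that fin finite_subset by (auto simp: generating_set_def)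
  show min: "minimal_generating_set S X"
    unfolding minimal_generating_set_def
    using fin gen free_generators_le_generating_set[OF assms(1,3)] fin_gen by blast
  fix Y assume Y: "minimal_generating_set S Y"
  then have genY: "generating_set S Y" "Y \<subseteq> carrier S"
    by (auto simp: minimal_generating_set_def generating_set_def)
  have "card X = card Y" using min Y genY gen
    by (intro antisym) (simp_all add: minimal_generating_set_def)
  then obtain f where f: "bij_betw f X Y"
    using finite_same_card_bij[OF assms(1) fin_gen[OF genY(1)]] by blast
  then have "f ` X \<subseteq> carrier S" using genY(2) by (simp add: bij_betw_def)
  then obtain h where h: "h \<in> skew_hom S S" "\<And>x. x \<in> X \<Longrightarrow> h x = f x"
    using free_on_universal[OF assms(3) V \<open>f ` X \<subseteq> carrier S\<close>] by blast
  have "h ` X = Y" using h(2) f by (simp add: bij_betw_def)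
  then have "h ` carrier S = carrier S"
    using skew_hom_image_generated[OF sba h(1) X] gen genY(1) by (simp add: generating_set_def)
  then have bij: "bij_betw h (carrier S) (carrier S)"
    using fin by (simp add: bij_betw_def eq_card_imp_inj_on)
  let ?k = "inv_into (carrier S) h"
  have k: "?k \<in> skew_hom S S" by (rule skew_hom_inverse[OF sba h(1) bij])
  show "free_on V S Y"
    unfolding free_on_def
  proof (intro conjI V genY(1) allI impI)
    fix T :: "'a skew_term skew_algebra" and g
    assume T: "in_variety V T \<and> g ` Y \<subseteq> carrier T"
    then have gf: "(g \<circ> f) ` X \<subseteq> carrier T" using f by (auto simp: bij_betw_def)
    then obtain m where m: "m \<in> skew_hom S T" "\<And>x. x \<in> X \<Longrightarrow> m x = (g \<circ> f) x"
      using free_on_universal[OF assms(3) conjunct1[OF T] gf] by blast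
    show "\<exists>m'\<in>skew_hom S T. \<forall>y\<in>Y. m' y = g y"
    proof (rule bexI[of _ "m \<circ> ?k"], intro ballI)
      fix y assume "y \<in> Y"
      then obtain x where x: "x \<in> X" "y = h x" using \<open>h ` X = Y\<close> by blast
      then have "?k y = x" using bij X by (auto simp: bij_betw_def)
      then show "(m \<circ> ?k) y = g y" using x m(2) h(2) by simp
    qed (rule skew_hom_comp[OF k m(1)])
  qed
qed

end
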